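(* Let $\mathcal{A}$ be a ternary Jordan algebra over a field $\mathrm{F}$ and let $\mathscr{A}$ be a commutative associative algebra over $\mathrm{F}$. On the vector space $\tilde{\mathcal{A}}=\mathcal{A}\otimes\mathscr{A}$ define a trilinear multiplication by $$[\![x\otimes a,y\otimes b,z\otimes c]\!]'=[\![x,y,z]\!]\otimes abc,\qquad\forall x,y,z\in\mathcal{A},\ a,b,c\in\mathscr{A}.$$ Then $(\tilde{\mathcal{A}},[\![\cdot,\cdot,\cdot]\!]')$ is also a ternary Jordan algebra. Moreover, if $\mathcal{A}$ is perfect and $\mathscr{A}$ is unital, then $\tilde{\mathcal{A}}$ is also perfect.
   Context: A ternary Jordan algebra over a field $\mathrm{F}$ is an $\mathrm{F}$-vector space $\mathcal{A}$ with a trilinear map $[\![\cdot,\cdot,\cdot]\!]:\mathcal{A}^3\to\mathcal{A}$ that is invariant under all permutations of its arguments and such that for all $x_2,x_3,y_2,y_3\in\mathcal{A}$ the commutator $[R_{(x_2,x_3)},R_{(y_2,y_3)}]$ is a derivation of $\mathcal{A}$, where $R_{(y_2,y_3)}(y)=[\![y,y_2,y_3]\!]$; a derivation is a linear map $D$ with $D([\![x,y,z]\!])=[\![D(x),y,z]\!]+[\![x,D(y),z]\!]+[\![x,y,D(z)]\!]$ for all $x,y,z$. A ternary Jordan algebra $\mathcal{A}$ is perfect if $[\![\mathcal{A},\mathcal{A},\mathcal{A}]\!]=\mathcal{A}$, where $[\![\mathcal{A},\mathcal{A},\mathcal{A}]\!]$ is the linear span of all products. Tensor products are over $\mathrm{F}$.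 *)

theory Defs
  imports "HOL-Algebra.AbelCoset" "Jordan_Normal_Form.Missing_VectorSpace"
begin

definition trilinear ::
    "('f, 'm) ring_scheme \<Rightarrow> ('f, 'a, 'k) module_scheme \<Rightarrow> ('a \<Rightarrow> 'a \<Rightarrow> 'a \<Rightarrow> 'a) \<Rightarrow> bool" where
  "trilinear F V t \<longleftrightarrow>
     (\<forall>y \<in> carrier V. \<forall>z \<in> carrier V.
        (\<lambda>x. t x y z) \<in> module_hom F V V \<and>
        (\<lambda>x. t y x z) \<in> module_hom F V V \<and>
        (\<lambda>x. t y z x) \<in> module_hom F V V)"

definition derivation ::
    "('f, 'm) ring_scheme \<Rightarrow> ('f, 'a, 'k) module_scheme \<Rightarrow> ('a \<Rightarrow> 'a \<Rightarrow> 'a \<Rightarrow> 'a) \<Rightarrow> ('a \<Rightarrow> 'a) \<Rightarrow> bool" where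
  "derivation F V t D \<longleftrightarrow>
     D \<in> module_hom F V V \<and>
     (\<forall>x \<in> carrier V. \<forall>y \<in> carrier V. \<forall>z \<in> carrier V.
        D (t x y z) = t (D x) y z \<oplus>\<^bsub>V\<^esub> t x (D y) z \<oplus>\<^bsub>V\<^esub> t x y (D z))"

definition mult_operator :: "('a \<Rightarrow> 'a \<Rightarrow> 'a \<Rightarrow> 'a) \<Rightarrow> 'a \<Rightarrow> 'a \<Rightarrow> ('a \<Rightarrow> 'a)" where
  "mult_operator t y2 y3 = (\<lambda>y. t y y2 y3)"

definition commutator ::
    "('f, 'a, 'k) module_scheme \<Rightarrow> ('a \<Rightarrow> 'a) \<Rightarrow> ('a \<Rightarrow> 'a) \<Rightarrow> ('a \<Rightarrow> 'a)" where
  "commutator V S T = (\<lambda>v. S (T v) \<ominus>\<^bsub>V\<^esub> T (S v))"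

text \<open>
  The vector space is given by the additive part and the scalar multiplication of
  the record \<open>V\<close>; its fields for a binary product and a unit are not used.
\<close>
locale ternary_jordan_algebra = vectorspace F V
  for F :: "('f, 'm) ring_scheme" and V :: "('f, 'a, 'k) module_scheme" +
  fixes t :: "'a \<Rightarrow> 'a \<Rightarrow> 'a \<Rightarrow> 'a"
  assumes bracket_trilinear: "trilinear F V t"
    and bracket_symmetric:
      "\<lbrakk> x \<in> carrier V; y \<in> carrier V; z \<in> carrier V \<rbrakk> \<Longrightarrow>
         t x z y = t x y z \<and> t y x z = t x y z \<and> t y z x = t x y z \<and>
         t z x y = t x y z \<and> t z y x = t x y z"
    and commutator_derivation:
      "\<lbrakk> x2 \<in> carrier V; x3 \<in> carrier V; y2 \<in> carrier V; y3 \<in> carrier V \<rbrakk> \<Longrightarrow>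
         derivation F V t (commutator V (mult_operator t x2 x3) (mult_operator t y2 y3))"

definition perfect ::
    "('f, 'm) ring_scheme \<Rightarrow> ('f, 'a, 'k) module_scheme \<Rightarrow> ('a \<Rightarrow> 'a \<Rightarrow> 'a \<Rightarrow> 'a) \<Rightarrow> bool" where
  "perfect F V t \<longleftrightarrow>
     module.span F V {t x y z | x y z. x \<in> carrier V \<and> y \<in> carrier V \<and> z \<in> carrier V} = carrier V"

text \<open>
  No unit is required, so the locale \<open>algebra\<close> of HOL-Algebra does not fit.
  Linearity in the second argument follows by commutativity. The field \<open>one\<close> of the
  record is not used.
\<close>
locale comm_assoc_algebra = vectorspace F B
  for F :: "('f, 'm) ring_scheme" and B :: "('f, 'b, 'l) module_scheme" +
  assumes alg_mult_linear: "b \<in> carrier B \<Longrightarrow> (\<lambda>a. a \<otimes>\<^bsub>B\<^esub> b) \<in> module_hom F B B"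
    and alg_mult_assoc:
      "\<lbrakk> a \<in> carrier B; b \<in> carrier B; c \<in> carrier B \<rbrakk> \<Longrightarrow>
         (a \<otimes>\<^bsub>B\<^esub> b) \<otimes>\<^bsub>B\<^esub> c = a \<otimes>\<^bsub>B\<^esub> (b \<otimes>\<^bsub>B\<^esub> c)"
    and alg_mult_comm:
      "\<lbrakk> a \<in> carrier B; b \<in> carrier B \<rbrakk> \<Longrightarrow> a \<otimes>\<^bsub>B\<^esub> b = b \<otimes>\<^bsub>B\<^esub> a"

definition unital :: "('f, 'b, 'l) module_scheme \<Rightarrow> bool" where
  "unital B \<longleftrightarrow>
     (\<exists>u \<in> carrier B. \<forall>a \<in> carrier B. u \<otimes>\<^bsub>B\<^esub> a = a \<and> a \<otimes>\<^bsub>B\<^esub> u = a)"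

text \<open>
  The tensor product is the free vector space on the pairs of vectors modulo the
  subspace generated by the bilinearity relations. The free vector space on \<open>S\<close> consists
  of the functions of finite support in \<open>func_space S\<close>.
\<close>
definition free_space :: "('f, 'm) ring_scheme \<Rightarrow> 's set \<Rightarrow> ('f, 's \<Rightarrow> 'f) module" where
  "free_space F S =
     (ring.func_space F S)
       \<lparr>carrier := {f \<in> S \<rightarrow>\<^sub>E carrier F. finite {s \<in> S. f s \<noteq> \<zero>\<^bsub>F\<^esub>}}\<rparr>"

definition free_gen :: "('f, 'm) ring_scheme \<Rightarrow> 's set \<Rightarrow> 's \<Rightarrow> ('s \<Rightarrow> 'f)" where
  "free_gen F S s = (\<lambda>u\<in>S. if u = s then \<one>\<^bsub>F\<^esub> else \<zero>\<^bsub>F\<^esub>)"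

definition quotient_space ::
    "('f, 'v, 'k) module_scheme \<Rightarrow> 'v set \<Rightarrow> ('f, 'v set) module" where
  "quotient_space V N =
     \<lparr>carrier = a_rcosets\<^bsub>V\<^esub> N, mult = undefined, one = undefined,
      zero = N, add = (<+>\<^bsub>V\<^esub>),
      smult = (\<lambda>r X. \<Union>v\<in>X. N +>\<^bsub>V\<^esub> (r \<odot>\<^bsub>V\<^esub> v))\<rparr>"

abbreviation pair_space ::
    "('f, 'm) ring_scheme \<Rightarrow> ('f, 'a, 'k) module_scheme \<Rightarrow> ('f, 'b, 'l) module_scheme
      \<Rightarrow> ('f, 'a \<times> 'b \<Rightarrow> 'f) module" where
  "pair_space F V W \<equiv> free_space F (carrier V \<times> carrier W)"

abbreviation pair_gen ::
    "('f, 'm) ring_scheme \<Rightarrow> ('f, 'a, 'k) module_scheme \<Rightarrow> ('f, 'b, 'l) module_scheme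
      \<Rightarrow> 'a \<Rightarrow> 'b \<Rightarrow> ('a \<times> 'b \<Rightarrow> 'f)" where
  "pair_gen F V W v w \<equiv> free_gen F (carrier V \<times> carrier W) (v, w)"

definition bilinear_relations ::
    "('f, 'm) ring_scheme \<Rightarrow> ('f, 'a, 'k) module_scheme \<Rightarrow> ('f, 'b, 'l) module_scheme
      \<Rightarrow> ('a \<times> 'b \<Rightarrow> 'f) set" where
  "bilinear_relations F V W =
     (let P = pair_space F V W; e = pair_gen F V W in
       {e (v \<oplus>\<^bsub>V\<^esub> v') w \<ominus>\<^bsub>P\<^esub> (e v w \<oplus>\<^bsub>P\<^esub> e v' w)
          | v v' w. v \<in> carrier V \<and> v' \<in> carrier V \<and> w \<in> carrier W} \<union>
       {e v (w \<oplus>\<^bsub>W\<^esub> w') \<ominus>\<^bsub>P\<^esub> (e v w \<oplus>\<^bsub>P\<^esub> e v w')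
          | v w w'. v \<in> carrier V \<and> w \<in> carrier W \<and> w' \<in> carrier W} \<union>
       {e (r \<odot>\<^bsub>V\<^esub> v) w \<ominus>\<^bsub>P\<^esub> (r \<odot>\<^bsub>P\<^esub> e v w)
          | r v w. r \<in> carrier F \<and> v \<in> carrier V \<and> w \<in> carrier W} \<union>
       {e v (r \<odot>\<^bsub>W\<^esub> w) \<ominus>\<^bsub>P\<^esub> (r \<odot>\<^bsub>P\<^esub> e v w)
          | r v w. r \<in> carrier F \<and> v \<in> carrier V \<and> w \<in> carrier W})"

definition relation_space ::
    "('f, 'm) ring_scheme \<Rightarrow> ('f, 'a, 'k) module_scheme \<Rightarrow> ('f, 'b, 'l) module_scheme
      \<Rightarrow> ('a \<times> 'b \<Rightarrow> 'f) set" where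
  "relation_space F V W = module.span F (pair_space F V W) (bilinear_relations F V W)"

definition tensor_product ::
    "('f, 'm) ring_scheme \<Rightarrow> ('f, 'a, 'k) module_scheme \<Rightarrow> ('f, 'b, 'l) module_scheme
      \<Rightarrow> ('f, ('a \<times> 'b \<Rightarrow> 'f) set) module" where
  "tensor_product F V W = quotient_space (pair_space F V W) (relation_space F V W)"

definition pure_tensor ::
    "('f, 'm) ring_scheme \<Rightarrow> ('f, 'a, 'k) module_scheme \<Rightarrow> ('f, 'b, 'l) module_scheme
      \<Rightarrow> 'a \<Rightarrow> 'b \<Rightarrow> ('a \<times> 'b \<Rightarrow> 'f) set" where
  "pure_tensor F V W v w = relation_space F V W +>\<^bsub>pair_space F V W\<^esub> pair_gen F V W v w"

text \<open>
  Pure tensors span the tensor product, so a trilinear map on it is determined by the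
  second condition.
\<close>
definition is_tensor_bracket ::
    "('f, 'm) ring_scheme \<Rightarrow> ('f, 'a, 'k) module_scheme \<Rightarrow> ('a \<Rightarrow> 'a \<Rightarrow> 'a \<Rightarrow> 'a)
      \<Rightarrow> ('f, 'b, 'l) module_scheme
      \<Rightarrow> (('a \<times> 'b \<Rightarrow> 'f) set \<Rightarrow> ('a \<times> 'b \<Rightarrow> 'f) set \<Rightarrow> ('a \<times> 'b \<Rightarrow> 'f) set
           \<Rightarrow> ('a \<times> 'b \<Rightarrow> 'f) set) \<Rightarrow> bool" where
  "is_tensor_bracket F A t B t' \<longleftrightarrow>
     trilinear F (tensor_product F A B) t' \<and>
     (\<forall>x \<in> carrier A. \<forall>y \<in> carrier A. \<forall>z \<in> carrier A.
      \<forall>a \<in> carrier B. \<forall>b \<in> carrier B. \<forall>c \<in> carrier B.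
        t' (pure_tensor F A B x a) (pure_tensor F A B y b) (pure_tensor F A B z c) =
        pure_tensor F A B (t x y z) (a \<otimes>\<^bsub>B\<^esub> b \<otimes>\<^bsub>B\<^esub> c))"

end

theory Submission
  imports Defs
begin

text \<open>
  The bracket is obtained by lifting the formula on pure tensors one argument at a time: after each
  step the map is still bilinear in every remaining pair \<open>(y, b)\<close>, because a lift depends linearly
  on the bilinear map that is lifted.

  Every element is a sum of pure tensors, so identities between multilinear maps are checked on
  pure tensors. There the commutator of two multiplication operators is
  \<open>v \<otimes> c \<mapsto> D v \<otimes> p c\<close>, with \<open>D\<close> the commutator in the given algebra
  and \<open>p\<close> the product of the four scalars involved; this is a derivation since the coefficients
  commute. Perfectness follows from \<open>[x, y, z] \<otimes> a = [x \<otimes> a, y \<otimes> 1, z \<otimes> 1]\<close>.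
\<close>


section \<open>Quotients and free modules\<close>

context submodule
begin

text \<open>Closure under negation comes from closure under the scalar \<open>-1\<close>. This gives
  access to the theory of cosets of additive subgroups.\<close>

lemma abelian_subgroup: "abelian_subgroup N M"
proof -
  note closed = zero_closed m_closed smult_closed
  interpret module R M by (rule module)
  have "subgroup N (add_monoid M)"
  proof (rule add.subgroupI)
    show "N \<subseteq> carrier M" "N \<noteq> {}"
      using subset closed(1) by blast+
    fix a b assume a: "a \<in> N" and "b \<in> N"
    then show "a \<oplus>\<^bsub>M\<^esub> b \<in> N" by (rule closed(2))
    have "(\<ominus>\<^bsub>R\<^esub> \<one>\<^bsub>R\<^esub>) \<odot>\<^bsub>M\<^esub> a \<in> N" using a by (intro closed(3)) auto
    moreover have "(\<ominus>\<^bsub>R\<^esub> \<one>\<^bsub>R\<^esub>) \<odot>\<^bsub>M\<^esub> a = \<ominus>\<^bsub>M\<^esub> a"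
      using a subset by (intro smult_minus_1) auto
    ultimately show "\<ominus>\<^bsub>M\<^esub> a \<in> N" by simp
  qed
  then show ?thesis
    by (intro abelian_subgroupI3 additive_subgroup.intro M.abelian_group_axioms)
qed

lemma coset_eqI:
  assumes "v \<in> N +>\<^bsub>M\<^esub> w" "w \<in> carrier M"
  shows "N +>\<^bsub>M\<^esub> v = N +>\<^bsub>M\<^esub> w"
proof -
  interpret abelian_subgroup N M by (rule abelian_subgroup)
  show ?thesis using a_repr_independence[OF assms a_subgroup] by simp
qed

lemma coset_self: "v \<in> carrier M \<Longrightarrow> v \<in> N +>\<^bsub>M\<^esub> v"
  using abelian_subgroup by (rule abelian_subgroup.a_rcos_self)

lemma coset_zero: "v \<in> N \<Longrightarrow> N +>\<^bsub>M\<^esub> v = N"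
  using abelian_subgroup by (rule abelian_subgroup.a_rcos_const)

text \<open>The union in \<open>quotient_space\<close> runs over all representatives of a coset. If
  \<open>w = n + v\<close> with \<open>n\<close> in \<open>N\<close>, then \<open>r w\<close> and
  \<open>r v\<close> differ by \<open>r n\<close>, again in \<open>N\<close>. So all members of the
  union are one and the same coset, and the union is nonempty because \<open>v\<close> is a
  representative.\<close>

lemma coset_smult:
  assumes r: "r \<in> carrier R" and v: "v \<in> carrier M"
  shows "r \<odot>\<^bsub>quotient_space M N\<^esub> (N +>\<^bsub>M\<^esub> v) = N +>\<^bsub>M\<^esub> (r \<odot>\<^bsub>M\<^esub> v)"
proof -
  interpret module R M by (rule module)
  have "N +>\<^bsub>M\<^esub> (r \<odot>\<^bsub>M\<^esub> w) = N +>\<^bsub>M\<^esub> (r \<odot>\<^bsub>M\<^esub> v)" if w: "w \<in> N +>\<^bsub>M\<^esub> v" for w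
  proof -
    obtain n where n: "n \<in> N" "w = n \<oplus>\<^bsub>M\<^esub> v"
      using w unfolding a_r_coset_def r_coset_def by auto
    have "r \<odot>\<^bsub>M\<^esub> w = r \<odot>\<^bsub>M\<^esub> n \<oplus>\<^bsub>M\<^esub> r \<odot>\<^bsub>M\<^esub> v"
      using n r v subset by (auto simp: smult_r_distr)
    moreover have "r \<odot>\<^bsub>M\<^esub> n \<in> N" using n r by (auto intro: smult_closed)
    ultimately have "r \<odot>\<^bsub>M\<^esub> w \<in> N +>\<^bsub>M\<^esub> (r \<odot>\<^bsub>M\<^esub> v)"
      unfolding a_r_coset_def r_coset_def by auto
    then show ?thesis using r v by (intro coset_eqI) auto
  qed
  then have "(\<Union>w\<in>N +>\<^bsub>M\<^esub> v. N +>\<^bsub>M\<^esub> (r \<odot>\<^bsub>M\<^esub> w)) = N +>\<^bsub>M\<^esub> (r \<odot>\<^bsub>M\<^esub> v)"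
    using coset_self[OF v] by (intro SUP_eq_const) blast+
  then show ?thesis by (simp add: quotient_space_def)
qed

lemma coset_add:
  assumes "v \<in> carrier M" "w \<in> carrier M"
  shows "(N +>\<^bsub>M\<^esub> v) \<oplus>\<^bsub>quotient_space M N\<^esub> (N +>\<^bsub>M\<^esub> w) = N +>\<^bsub>M\<^esub> (v \<oplus>\<^bsub>M\<^esub> w)"
  using abelian_subgroup.a_rcos_sum[OF abelian_subgroup assms]
  unfolding quotient_space_def by simp

lemma coset_closed: "v \<in> carrier M \<Longrightarrow> N +>\<^bsub>M\<^esub> v \<in> carrier (quotient_space M N)"
  unfolding quotient_space_def A_RCOSETS_def RCOSETS_def a_r_coset_def by auto

lemma quotient_cases:
  assumes "X \<in> carrier (quotient_space M N)"
  obtains v where "v \<in> carrier M" "X = N +>\<^bsub>M\<^esub> v"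
  using assms unfolding quotient_space_def A_RCOSETS_def RCOSETS_def a_r_coset_def by auto

lemma quotient_module: "module R (quotient_space M N)"
proof -
  note zero = zero_closed
  interpret module R M by (rule module)
  let ?Q = "quotient_space M N"
  \<comment> \<open>The zero of the quotient is defined as \<open>N\<close>; written as a coset it
    falls under the same computation rules as every other element.\<close>
  have zero: "\<zero>\<^bsub>?Q\<^esub> = N +>\<^bsub>M\<^esub> \<zero>\<^bsub>M\<^esub>"
    using coset_zero[OF zero] by (simp add: quotient_space_def)
  have "abelian_group ?Q"
  proof (rule abelian_groupI)
    fix X assume "X \<in> carrier ?Q"
    then obtain v where v: "v \<in> carrier M" "X = N +>\<^bsub>M\<^esub> v" by (rule quotient_cases)
    then show "\<exists>Y\<in>carrier ?Q. Y \<oplus>\<^bsub>?Q\<^esub> X = \<zero>\<^bsub>?Q\<^esub>"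
      by (intro bexI[of _ "N +>\<^bsub>M\<^esub> (\<ominus>\<^bsub>M\<^esub> v)"])
        (auto simp: coset_add coset_closed zero M.l_neg)
  qed (auto elim!: quotient_cases simp: coset_add coset_closed zero M.a_ac)
  then show ?thesis
    by (rule moduleI[OF is_cring])
      (auto elim!: quotient_cases simp: coset_smult coset_add coset_closed smult_l_distr
        smult_r_distr smult_assoc1)
qed

text \<open>The map \<open>g\<close> applies \<open>f\<close> to an arbitrarily chosen member of a
  coset. Any member is \<open>n + v\<close> with \<open>n\<close> in \<open>N\<close>, and
  \<open>f\<close> vanishes on \<open>N\<close>, so the choice has no influence and linearity is
  inherited from \<open>f\<close>.\<close>

lemma quotient_lift:
  assumes W: "module R W" and f: "f \<in> module_hom R M W"
    and 0: "\<And>n. n \<in> N \<Longrightarrow> f n = \<zero>\<^bsub>W\<^esub>"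
  shows "\<exists>g \<in> module_hom R (quotient_space M N) W. \<forall>v \<in> carrier M. g (N +>\<^bsub>M\<^esub> v) = f v"
proof -
  interpret module R M by (rule module)
  interpret W: module R W by (rule W)
  define g where "g X = f (SOME v. v \<in> X)" for X
  have g: "g (N +>\<^bsub>M\<^esub> v) = f v" if v: "v \<in> carrier M" for v
  proof -
    have "(SOME w. w \<in> N +>\<^bsub>M\<^esub> v) \<in> N +>\<^bsub>M\<^esub> v"
      using coset_self[OF v] by (rule someI)
    then obtain n where n: "n \<in> N" and "(SOME w. w \<in> N +>\<^bsub>M\<^esub> v) = n \<oplus>\<^bsub>M\<^esub> v"
      unfolding a_r_coset_def r_coset_def by auto
    then have "g (N +>\<^bsub>M\<^esub> v) = f n \<oplus>\<^bsub>W\<^esub> f v"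
      unfolding g_def using module_hom_add[OF f] n v subset by auto
    moreover have "f v \<in> carrier W" using v module_hom_closed[OF f] by auto
    ultimately show ?thesis using 0[OF n] by simp
  qed
  moreover have "g \<in> module_hom R (quotient_space M N) W"
    unfolding module_hom_def
    using module_hom_closed[OF f] module_hom_add[OF f] module_hom_smult[OF f]
    by (auto elim!: quotient_cases simp: coset_smult coset_add g)
  ultimately show ?thesis by blast
qed

end

section \<open>Free modules on a set\<close>

context cring
begin

lemma free_space_sel:
  "carrier (free_space R S) = {f \<in> S \<rightarrow>\<^sub>E carrier R. finite {s \<in> S. f s \<noteq> \<zero>}}"
  "\<zero>\<^bsub>free_space R S\<^esub> = (\<lambda>s\<in>S. \<zero>)"
  "f \<oplus>\<^bsub>free_space R S\<^esub> g = (\<lambda>s\<in>S. f s \<oplus> g s)"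
  "r \<odot>\<^bsub>free_space R S\<^esub> f = (\<lambda>s\<in>S. r \<otimes> f s)"
  unfolding free_space_def func_space_def by simp_all

text \<open>The support of a sum lies in the union of the two supports, and that of a scalar
  multiple in the original support. Hence the functions of finite support form a submodule of all
  functions on \<open>S\<close>.\<close>

lemma free_space_module: "module R (free_space R S)"
proof -
  interpret P: module R "func_space S" by (rule func_space_is_module)
  have "submodule R (carrier (free_space R S)) (func_space S)"
  proof (rule submodule.intro)
    show "module R (func_space S)" by (rule P.module_axioms)
    show "carrier (free_space R S) \<subseteq> carrier (func_space S)"
      by (auto simp: free_space_sel func_space_def)
    show "\<zero>\<^bsub>func_space S\<^esub> \<in> carrier (free_space R S)"
      by (auto simp: free_space_sel func_space_def)
    fix f g r
    assume f: "f \<in> carrier (free_space R S)"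
    {
      assume g: "g \<in> carrier (free_space R S)"
      have "finite {s \<in> S. f s \<oplus> g s \<noteq> \<zero>}"
        by (rule finite_subset[of _ "{s \<in> S. f s \<noteq> \<zero>} \<union> {s \<in> S. g s \<noteq> \<zero>}"])
          (use f g in \<open>auto simp: free_space_sel\<close>)
      then show "f \<oplus>\<^bsub>func_space S\<^esub> g \<in> carrier (free_space R S)"
        using f g by (auto simp: free_space_sel func_space_def PiE_def Pi_def cong: conj_cong)
    }
    {
      assume r: "r \<in> carrier R"
      have "finite {s \<in> S. r \<otimes> f s \<noteq> \<zero>}"
        by (rule finite_subset[of _ "{s \<in> S. f s \<noteq> \<zero>}"])
          (use f r in \<open>auto simp: free_space_sel\<close>)
      then show "r \<odot>\<^bsub>func_space S\<^esub> f \<in> carrier (free_space R S)"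
        using f r by (auto simp: free_space_sel func_space_def PiE_def Pi_def cong: conj_cong)
    }
  qed
  then have "module R (func_space S\<lparr>carrier := carrier (free_space R S)\<rparr>)"
    by (rule P.submodule_is_module)
  then show ?thesis unfolding free_space_def by simp
qed

lemma free_gen_closed: "s \<in> S \<Longrightarrow> free_gen R S s \<in> carrier (free_space R S)"
  by (auto simp: free_space_sel free_gen_def cong: conj_cong)

text \<open>Induction on the support: \<open>f\<close> splits into \<open>h\<close>, which is
  \<open>f\<close> with its value at one point \<open>x\<close> of the support replaced by zero, and
  \<open>f x\<close> times the generator at \<open>x\<close>.\<close>

lemma free_space_generated:
  assumes N: "submodule R N (free_space R S)" and gen: "\<And>s. s \<in> S \<Longrightarrow> free_gen R S s \<in> N"
    and f: "f \<in> carrier (free_space R S)"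
  shows "f \<in> N"
proof -
  interpret N: submodule R N "free_space R S" by (rule N)
  have "finite X \<Longrightarrow> f \<in> carrier (free_space R S) \<Longrightarrow> {s \<in> S. f s \<noteq> \<zero>} = X \<Longrightarrow> f \<in> N" for X f
  proof (induction X arbitrary: f rule: finite_induct)
    case empty
    then have "f s = \<zero>" if "s \<in> S" for s using that by auto
    with empty have "f = \<zero>\<^bsub>free_space R S\<^esub>"
      by (auto simp: free_space_sel PiE_def extensional_def restrict_def)
    then show ?case by simp
  next
    case (insert x X)
    have x: "x \<in> S" using insert.prems by auto
    define h where "h = f(x := \<zero>)"
    have sub: "{s \<in> S. h s \<noteq> \<zero>} = X"
      using insert.prems(2) insert.hyps(2) by (auto simp: h_def)
    have "h \<in> carrier (free_space R S)"
      using insert.prems(1) sub insert.hyps(1) x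
      by (auto simp: free_space_sel h_def PiE_def Pi_def extensional_def cong: conj_cong)
    then have "h \<in> N" using sub by (rule insert.IH)
    moreover have "f x \<odot>\<^bsub>free_space R S\<^esub> free_gen R S x \<in> N"
      using x insert.prems(1) by (intro N.smult_closed gen) (auto simp: free_space_sel)
    moreover have "f = h \<oplus>\<^bsub>free_space R S\<^esub> (f x \<odot>\<^bsub>free_space R S\<^esub> free_gen R S x)"
    proof
      fix s show "f s = (h \<oplus>\<^bsub>free_space R S\<^esub> (f x \<odot>\<^bsub>free_space R S\<^esub> free_gen R S x)) s"
        using insert.prems(1)
        by (cases "s \<in> S") (auto simp: free_space_sel h_def free_gen_def PiE_def Pi_def extensional_def x)
    qed
    ultimately show ?case using N.m_closed by metis
  qed
  then show ?thesis using f by (auto simp: free_space_sel)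
qed

text \<open>Universal property of the free module: the extension sends \<open>f\<close> to the
  linear combination of the values \<open>g s\<close> with coefficients \<open>f s\<close>, summed
  over the support of \<open>f\<close>.\<close>

lemma free_space_extend:
  assumes W: "module R W" and g: "g \<in> S \<rightarrow> carrier W"
  shows "\<exists>h \<in> module_hom R (free_space R S) W. \<forall>s \<in> S. h (free_gen R S s) = g s"
proof -
  interpret W: module R W by (rule W)
  define h where "h f = (\<Oplus>\<^bsub>W\<^esub>s\<in>{s \<in> S. f s \<noteq> \<zero>}. f s \<odot>\<^bsub>W\<^esub> g s)" for f
  \<comment> \<open>Indices outside the support contribute zero, so sums over different supports can
    be compared over one common finite set.\<close>
  have h: "h f = (\<Oplus>\<^bsub>W\<^esub>s\<in>X. f s \<odot>\<^bsub>W\<^esub> g s)"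
    if "f \<in> S \<rightarrow> carrier R" "finite X" "X \<subseteq> S" "{s \<in> S. f s \<noteq> \<zero>} \<subseteq> X" for f X
    unfolding h_def using that g
    by (intro W.add.finprod_mono_neutral_cong_left[folded finsum_def]) (auto simp: Pi_def)
  have "h \<in> module_hom R (free_space R S) W"
    unfolding module_hom_def
  proof (intro CollectI conjI allI impI)
    show "h \<in> carrier (free_space R S) \<rightarrow> carrier W"
      unfolding h_def using g by (auto simp: free_space_sel intro!: W.finsum_closed)
  next
    fix f1 f2
    assume f: "f1 \<in> carrier (free_space R S) \<and> f2 \<in> carrier (free_space R S)"
    let ?X = "{s \<in> S. f1 s \<noteq> \<zero>} \<union> {s \<in> S. f2 s \<noteq> \<zero>}"
    have "h (f1 \<oplus>\<^bsub>free_space R S\<^esub> f2) = (\<Oplus>\<^bsub>W\<^esub>s\<in>?X. (f1 \<oplus>\<^bsub>free_space R S\<^esub> f2) s \<odot>\<^bsub>W\<^esub> g s)"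
      using f by (intro h) (auto simp: free_space_sel)
    also have "\<dots> = (\<Oplus>\<^bsub>W\<^esub>s\<in>?X. f1 s \<odot>\<^bsub>W\<^esub> g s \<oplus>\<^bsub>W\<^esub> f2 s \<odot>\<^bsub>W\<^esub> g s)"
      using f g by (intro W.finsum_cong') (auto simp: free_space_sel W.smult_l_distr PiE_def Pi_def)
    also have "\<dots> = (\<Oplus>\<^bsub>W\<^esub>s\<in>?X. f1 s \<odot>\<^bsub>W\<^esub> g s) \<oplus>\<^bsub>W\<^esub> (\<Oplus>\<^bsub>W\<^esub>s\<in>?X. f2 s \<odot>\<^bsub>W\<^esub> g s)"
      using f g by (intro W.finsum_addf) (auto simp: free_space_sel PiE_def Pi_def)
    also have "\<dots> = h f1 \<oplus>\<^bsub>W\<^esub> h f2"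
      using f h[of f1 ?X] h[of f2 ?X] by (auto simp: free_space_sel PiE_def)
    finally show "h (f1 \<oplus>\<^bsub>free_space R S\<^esub> f2) = h f1 \<oplus>\<^bsub>W\<^esub> h f2" .
  next
    fix r f
    assume f: "r \<in> carrier R \<and> f \<in> carrier (free_space R S)"
    let ?X = "{s \<in> S. f s \<noteq> \<zero>}"
    have "h (r \<odot>\<^bsub>free_space R S\<^esub> f) = (\<Oplus>\<^bsub>W\<^esub>s\<in>?X. (r \<odot>\<^bsub>free_space R S\<^esub> f) s \<odot>\<^bsub>W\<^esub> g s)"
      using f by (intro h) (auto simp: free_space_sel)
    also have "\<dots> = (\<Oplus>\<^bsub>W\<^esub>s\<in>?X. r \<odot>\<^bsub>W\<^esub> (f s \<odot>\<^bsub>W\<^esub> g s))"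
      using f g by (intro W.finsum_cong') (auto simp: free_space_sel W.smult_assoc1 PiE_def Pi_def)
    also have "\<dots> = r \<odot>\<^bsub>W\<^esub> h f"
      unfolding h_def using f g
      by (intro W.finsum_smult[symmetric]) (auto simp: free_space_sel PiE_def Pi_def)
    finally show "h (r \<odot>\<^bsub>free_space R S\<^esub> f) = r \<odot>\<^bsub>W\<^esub> h f" .
  qed
  moreover have "h (free_gen R S s) = g s" if s: "s \<in> S" for s
  proof -
    \<comment> \<open>The support is contained in \<open>{s}\<close> but may be smaller: it is empty
      when one and zero coincide.\<close>
    have "h (free_gen R S s) = (\<Oplus>\<^bsub>W\<^esub>u\<in>{s}. free_gen R S s u \<odot>\<^bsub>W\<^esub> g u)"
      using s by (intro h) (auto simp: free_gen_def)
    also have "\<dots> = g s"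
      using s g by (auto simp: free_gen_def W.finsum_insert Pi_def)
    finally show ?thesis .
  qed
  ultimately show ?thesis by blast
qed

end

section \<open>The universal property of the tensor product\<close>

definition bilinear ::
    "('f, 'm) ring_scheme \<Rightarrow> ('f, 'a, 'k) module_scheme \<Rightarrow> ('f, 'b, 'l) module_scheme
      \<Rightarrow> ('f, 'c, 'n) module_scheme \<Rightarrow> ('a \<Rightarrow> 'b \<Rightarrow> 'c) \<Rightarrow> bool" where
  "bilinear F V W U \<beta> \<longleftrightarrow>
     (\<forall>w \<in> carrier W. (\<lambda>v. \<beta> v w) \<in> module_hom F V U) \<and>
     (\<forall>v \<in> carrier V. \<beta> v \<in> module_hom F W U)"

locale tensor = V: module F V + W: module F W
  for F :: "('f, 'm) ring_scheme" and V :: "('f, 'a, 'k) module_scheme"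
    and W :: "('f, 'b, 'l) module_scheme"
begin

abbreviation "P \<equiv> pair_space F V W"
abbreviation "e \<equiv> pair_gen F V W"
abbreviation "N \<equiv> relation_space F V W"
abbreviation "T \<equiv> tensor_product F V W"
abbreviation "pure \<equiv> pure_tensor F V W"

sublocale P: module F P
  by (rule V.R.free_space_module)

lemma gen_closed: "v \<in> carrier V \<Longrightarrow> w \<in> carrier W \<Longrightarrow> e v w \<in> carrier P"
  by (rule V.R.free_gen_closed) simp

lemma relations_closed: "bilinear_relations F V W \<subseteq> carrier P"
  unfolding bilinear_relations_def Let_def
  by (auto intro!: P.minus_closed P.a_closed P.smult_closed gen_closed
      V.a_closed W.a_closed V.smult_closed W.smult_closed)

sublocale N: submodule F N P
  unfolding relation_space_def by (rule P.span_is_submodule[OF relations_closed])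

lemma relation_in: "n \<in> bilinear_relations F V W \<Longrightarrow> n \<in> N"
  unfolding relation_space_def using P.in_own_span[OF relations_closed] by auto

sublocale T: module F T
  unfolding tensor_product_def by (rule N.quotient_module)

lemma pure_closed: "v \<in> carrier V \<Longrightarrow> w \<in> carrier W \<Longrightarrow> pure v w \<in> carrier T"
  unfolding tensor_product_def pure_tensor_def by (intro N.coset_closed gen_closed)

text \<open>Every generating relation is a difference of two elements, so it identifies their
  cosets. The four bilinearity laws for pure tensors are obtained in this way.\<close>

lemma coset_eq_of_diff:
  assumes "x \<ominus>\<^bsub>P\<^esub> y \<in> bilinear_relations F V W" "x \<in> carrier P" "y \<in> carrier P"
  shows "N +>\<^bsub>P\<^esub> x = N +>\<^bsub>P\<^esub> y"
proof (rule N.coset_eqI)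
  have "x = (x \<ominus>\<^bsub>P\<^esub> y) \<oplus>\<^bsub>P\<^esub> y"
    using assms(2,3) by (simp add: P.minus_eq P.a_assoc P.l_neg)
  then show "x \<in> N +>\<^bsub>P\<^esub> y"
    using relation_in[OF assms(1)] unfolding a_r_coset_def r_coset_def by auto
qed (rule assms(3))

lemma pure_add_left:
  assumes "v \<in> carrier V" "v' \<in> carrier V" "w \<in> carrier W"
  shows "pure (v \<oplus>\<^bsub>V\<^esub> v') w = pure v w \<oplus>\<^bsub>T\<^esub> pure v' w"
proof -
  have "N +>\<^bsub>P\<^esub> e (v \<oplus>\<^bsub>V\<^esub> v') w = N +>\<^bsub>P\<^esub> (e v w \<oplus>\<^bsub>P\<^esub> e v' w)"
  proof (rule coset_eq_of_diff)
    show "e (v \<oplus>\<^bsub>V\<^esub> v') w \<ominus>\<^bsub>P\<^esub> (e v w \<oplus>\<^bsub>P\<^esub> e v' w) \<in> bilinear_relations F V W"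
      unfolding bilinear_relations_def Let_def using assms by blast
  qed (use assms in \<open>auto intro!: gen_closed P.a_closed\<close>)
  then show ?thesis
    using assms by (simp add: pure_tensor_def tensor_product_def N.coset_add gen_closed)
qed

lemma pure_add_right:
  assumes "v \<in> carrier V" "w \<in> carrier W" "w' \<in> carrier W"
  shows "pure v (w \<oplus>\<^bsub>W\<^esub> w') = pure v w \<oplus>\<^bsub>T\<^esub> pure v w'"
proof -
  have "N +>\<^bsub>P\<^esub> e v (w \<oplus>\<^bsub>W\<^esub> w') = N +>\<^bsub>P\<^esub> (e v w \<oplus>\<^bsub>P\<^esub> e v w')"
  proof (rule coset_eq_of_diff)
    show "e v (w \<oplus>\<^bsub>W\<^esub> w') \<ominus>\<^bsub>P\<^esub> (e v w \<oplus>\<^bsub>P\<^esub> e v w') \<in> bilinear_relations F V W"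
      unfolding bilinear_relations_def Let_def using assms by blast
  qed (use assms in \<open>auto intro!: gen_closed P.a_closed\<close>)
  then show ?thesis
    using assms by (simp add: pure_tensor_def tensor_product_def N.coset_add gen_closed)
qed

lemma pure_smult_left:
  assumes "r \<in> carrier F" "v \<in> carrier V" "w \<in> carrier W"
  shows "pure (r \<odot>\<^bsub>V\<^esub> v) w = r \<odot>\<^bsub>T\<^esub> pure v w"
proof -
  have "N +>\<^bsub>P\<^esub> e (r \<odot>\<^bsub>V\<^esub> v) w = N +>\<^bsub>P\<^esub> (r \<odot>\<^bsub>P\<^esub> e v w)"
  proof (rule coset_eq_of_diff)
    show "e (r \<odot>\<^bsub>V\<^esub> v) w \<ominus>\<^bsub>P\<^esub> (r \<odot>\<^bsub>P\<^esub> e v w) \<in> bilinear_relations F V W"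
      unfolding bilinear_relations_def Let_def using assms by blast
  qed (use assms in \<open>auto intro!: gen_closed P.smult_closed\<close>)
  then show ?thesis
    using assms by (simp add: pure_tensor_def tensor_product_def N.coset_smult gen_closed)
qed

lemma pure_smult_right:
  assumes "r \<in> carrier F" "v \<in> carrier V" "w \<in> carrier W"
  shows "pure v (r \<odot>\<^bsub>W\<^esub> w) = r \<odot>\<^bsub>T\<^esub> pure v w"
proof -
  have "N +>\<^bsub>P\<^esub> e v (r \<odot>\<^bsub>W\<^esub> w) = N +>\<^bsub>P\<^esub> (r \<odot>\<^bsub>P\<^esub> e v w)"
  proof (rule coset_eq_of_diff)
    show "e v (r \<odot>\<^bsub>W\<^esub> w) \<ominus>\<^bsub>P\<^esub> (r \<odot>\<^bsub>P\<^esub> e v w) \<in> bilinear_relations F V W"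
      unfolding bilinear_relations_def Let_def using assms by blast
  qed (use assms in \<open>auto intro!: gen_closed P.smult_closed\<close>)
  then show ?thesis
    using assms by (simp add: pure_tensor_def tensor_product_def N.coset_smult gen_closed)
qed

lemma pure_bilinear: "bilinear F V W T pure"
  unfolding bilinear_def module_hom_def
  by (auto simp: pure_closed pure_add_left pure_add_right pure_smult_left pure_smult_right)

text \<open>No scalar step is needed, since \<open>r (v \<otimes> w) = (r v) \<otimes> w\<close> is again pure.\<close>

lemma tensor_induct [consumes 1, case_names pure add]:
  assumes X: "X \<in> carrier T"
    and pure: "\<And>v w. v \<in> carrier V \<Longrightarrow> w \<in> carrier W \<Longrightarrow> Q (pure v w)"
    and add: "\<And>X Y. X \<in> carrier T \<Longrightarrow> Y \<in> carrier T \<Longrightarrow> Q X \<Longrightarrow> Q Y \<Longrightarrow> Q (X \<oplus>\<^bsub>T\<^esub> Y)"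
  shows "Q X"
proof -
  \<comment> \<open>\<open>Q\<close> is not assumed to be stable under scalars. Demanding it of all
    scalar multiples gives a stronger property that is stable; the scalar one recovers
    \<open>Q X\<close> at the end.\<close>
  define S where "S = {X \<in> carrier T. \<forall>r \<in> carrier F. Q (r \<odot>\<^bsub>T\<^esub> X)}"
  have Q_pure: "Q (r \<odot>\<^bsub>T\<^esub> pure v w)" if "r \<in> carrier F" "v \<in> carrier V" "w \<in> carrier W" for r v w
    using that pure[of "r \<odot>\<^bsub>V\<^esub> v" w] by (simp add: pure_smult_left)
  \<comment> \<open>The zero tensor is itself pure, so the pure case also covers zero.\<close>
  have zero: "pure \<zero>\<^bsub>V\<^esub> \<zero>\<^bsub>W\<^esub> = \<zero>\<^bsub>T\<^esub>"
    using pure_smult_left[of "\<zero>\<^bsub>F\<^esub>" "\<zero>\<^bsub>V\<^esub>" "\<zero>\<^bsub>W\<^esub>"] pure_closed[of "\<zero>\<^bsub>V\<^esub>" "\<zero>\<^bsub>W\<^esub>"] by simp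
  \<comment> \<open>Pulling \<open>S\<close> back to the free module turns the claim into one about
    a submodule containing all generators, which must be everything.\<close>
  define K where "K = {f \<in> carrier P. N +>\<^bsub>P\<^esub> f \<in> S}"
  have sub: "submodule F K P"
  proof (rule submodule.intro)
    have "\<zero>\<^bsub>T\<^esub> \<in> S"
      using Q_pure[of _ "\<zero>\<^bsub>V\<^esub>" "\<zero>\<^bsub>W\<^esub>"] by (auto simp: K_def S_def zero)
    moreover have "N +>\<^bsub>P\<^esub> \<zero>\<^bsub>P\<^esub> = \<zero>\<^bsub>T\<^esub>"
      using N.coset_zero[OF N.zero_closed] by (simp add: tensor_product_def quotient_space_def)
    ultimately show "\<zero>\<^bsub>P\<^esub> \<in> K" by (simp add: K_def)
  next
    fix f g assume "f \<in> K" "g \<in> K"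
    then show "f \<oplus>\<^bsub>P\<^esub> g \<in> K"
      using N.coset_add[of f g, folded tensor_product_def, symmetric]
      by (auto simp: K_def S_def T.smult_r_distr intro!: add)
  next
    fix r f assume "r \<in> carrier F" "f \<in> K"
    then show "r \<odot>\<^bsub>P\<^esub> f \<in> K"
      using N.coset_smult[of r f, folded tensor_product_def, symmetric]
      by (auto simp: K_def S_def T.smult_assoc1[symmetric])
  qed (auto simp: K_def intro: P.module_axioms)
  have e_K: "e v w \<in> K" if "v \<in> carrier V" "w \<in> carrier W" for v w
    using that Q_pure pure_closed gen_closed by (auto simp: K_def S_def pure_tensor_def)
  have gen: "f \<in> K" if "f \<in> carrier P" for f
    using sub _ that
  proof (rule V.R.free_space_generated)
    fix s assume "s \<in> carrier V \<times> carrier W"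
    then show "free_gen F (carrier V \<times> carrier W) s \<in> K" using e_K by (cases s) simp
  qed
  obtain f where f: "f \<in> carrier P" "X = N +>\<^bsub>P\<^esub> f"
    using X unfolding tensor_product_def by (rule N.quotient_cases)
  then have "\<forall>r \<in> carrier F. Q (r \<odot>\<^bsub>T\<^esub> X)" using gen[of f] by (simp add: K_def S_def)
  then have "Q (\<one>\<^bsub>F\<^esub> \<odot>\<^bsub>T\<^esub> X)" using V.R.one_closed by (rule bspec)
  then show ?thesis using X by simp
qed

section \<open>Lifting bilinear maps\<close>

text \<open>The linear extension of \<open>\<beta>\<close> to the free module kills each of the four
  kinds of relations, because \<open>\<beta>\<close> is bilinear. Its kernel is a submodule, so it
  contains their span \<open>N\<close>, and the extension passes to the quotient.\<close>

lemma tensor_lift_exists: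
  assumes U: "module F U" and \<beta>: "bilinear F V W U \<beta>"
  shows "\<exists>g \<in> module_hom F T U. \<forall>v \<in> carrier V. \<forall>w \<in> carrier W. g (pure v w) = \<beta> v w"
proof -
  interpret U: module F U by (rule U)
  have \<beta>_closed: "\<beta> v w \<in> carrier U" if "v \<in> carrier V" "w \<in> carrier W" for v w
    using \<beta> that by (auto simp: bilinear_def module_hom_def)
  then have "(\<lambda>(v, w). \<beta> v w) \<in> carrier V \<times> carrier W \<rightarrow> carrier U" by auto
  then obtain h where h: "h \<in> module_hom F P U"
    and "\<forall>s \<in> carrier V \<times> carrier W. h (free_gen F (carrier V \<times> carrier W) s) = (\<lambda>(v, w). \<beta> v w) s"
    using V.R.free_space_extend[OF U] by blast
  then have h_gen: "h (e v w) = \<beta> v w" if "v \<in> carrier V" "w \<in> carrier W" for v w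
    using that by simp
  interpret h: mod_hom F P U h by unfold_locales (rule h)
  have "bilinear_relations F V W \<subseteq> h.ker"
    using relations_closed \<beta>
    unfolding bilinear_relations_def Let_def h.ker_def
    by (auto simp: h.f_minus h_gen gen_closed module_hom_add[OF h] module_hom_smult[OF h]
        bilinear_def module_hom_def \<beta>_closed Pi_def)
  then have "N \<subseteq> h.ker"
    unfolding relation_space_def by (rule P.span_is_subset) (rule h.ker_is_submodule)
  then have "h n = \<zero>\<^bsub>U\<^esub>" if "n \<in> N" for n
    using that by (auto simp: h.ker_def)
  then obtain g where "g \<in> module_hom F T U" "\<And>x. x \<in> carrier P \<Longrightarrow> g (N +>\<^bsub>P\<^esub> x) = h x"
    using N.quotient_lift[OF U h] unfolding tensor_product_def by blast
  then show ?thesis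
    by (intro bexI[of _ g]) (auto simp: pure_tensor_def gen_closed h_gen)
qed

text \<open>For a module \<open>U\<close> and bilinear \<open>\<beta>\<close>, the values on pure
  tensors determine the map on \<open>carrier T\<close>, so the choice affects only arguments
  outside the carrier.\<close>

definition lift :: "('f, 'c, 'n) module_scheme \<Rightarrow> ('a \<Rightarrow> 'b \<Rightarrow> 'c) \<Rightarrow> ('a \<times> 'b \<Rightarrow> 'f) set \<Rightarrow> 'c" where
  "lift U \<beta> = (SOME g. g \<in> module_hom F T U \<and>
     (\<forall>v \<in> carrier V. \<forall>w \<in> carrier W. g (pure v w) = \<beta> v w))"

lemma
  assumes "module F U" and "bilinear F V W U \<beta>"
  shows lift_hom: "lift U \<beta> \<in> module_hom F T U"
    and lift_pure: "v \<in> carrier V \<Longrightarrow> w \<in> carrier W \<Longrightarrow> lift U \<beta> (pure v w) = \<beta> v w"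
  using someI_ex[OF tensor_lift_exists[OF assms, unfolded Bex_def], folded lift_def] by auto

text \<open>A lift depends linearly on a parameter \<open>m\<close> if the bilinear map does: this
  is the assumption at a pure tensor, and it carries over to sums because each lift is additive.
  This is what allows lifts to be iterated.\<close>

lemma lift_family:
  assumes M: "module F M" and U: "module F U"
    and \<beta>: "\<And>m. m \<in> carrier M \<Longrightarrow> bilinear F V W U (\<beta> m)"
    and hom: "\<And>v w. v \<in> carrier V \<Longrightarrow> w \<in> carrier W \<Longrightarrow> (\<lambda>m. \<beta> m v w) \<in> module_hom F M U"
    and X: "X \<in> carrier T"
  shows "(\<lambda>m. lift U (\<beta> m) X) \<in> module_hom F M U"
proof -
  interpret M: module F M by (rule M)
  interpret U: module F U by (rule U)
  note lh = lift_hom[OF U \<beta>] and lp = lift_pure[OF U \<beta>]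
  have closed: "lift U (\<beta> m) X \<in> carrier U" if "m \<in> carrier M" "X \<in> carrier T" for m X
    using module_hom_closed[OF lh] that by auto
  have "lift U (\<beta> (m \<oplus>\<^bsub>M\<^esub> m')) X = lift U (\<beta> m) X \<oplus>\<^bsub>U\<^esub> lift U (\<beta> m') X"
    if "m \<in> carrier M" "m' \<in> carrier M" for m m'
    using X
  proof (induction rule: tensor_induct)
    case (pure v w) then show ?case using that by (simp add: lp module_hom_add[OF hom])
  next
    case (add X Y) then show ?case using that by (simp add: module_hom_add[OF lh] closed U.a_ac)
  qed
  moreover have "lift U (\<beta> (r \<odot>\<^bsub>M\<^esub> m)) X = r \<odot>\<^bsub>U\<^esub> lift U (\<beta> m) X"
    if "r \<in> carrier F" "m \<in> carrier M" for r m
    using X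
  proof (induction rule: tensor_induct)
    case (pure v w) then show ?case using that by (simp add: lp module_hom_smult[OF hom])
  next
    case (add X Y) then show ?case using that
      by (simp add: module_hom_add[OF lh] closed U.smult_r_distr)
  qed
  ultimately show ?thesis
    using X closed unfolding module_hom_def by auto
qed

text \<open>The arguments are reduced to pure tensors one at a time, the third first; each reduction
  uses additivity of both maps in that argument.\<close>

lemma trilinear_eq:
  assumes f: "trilinear F T f" and g: "trilinear F T g"
    and eq: "\<And>x y z a b c. \<lbrakk>x \<in> carrier V; y \<in> carrier V; z \<in> carrier V;
       a \<in> carrier W; b \<in> carrier W; c \<in> carrier W\<rbrakk>
       \<Longrightarrow> f (pure x a) (pure y b) (pure z c) = g (pure x a) (pure y b) (pure z c)"
    and X: "X \<in> carrier T" and Y: "Y \<in> carrier T" and Z: "Z \<in> carrier T"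
  shows "f X Y Z = g X Y Z"
proof -
  have hom: "(\<lambda>x. h x y z) \<in> module_hom F T T" "(\<lambda>x. h y x z) \<in> module_hom F T T"
    "(\<lambda>x. h y z x) \<in> module_hom F T T"
    if "h \<in> {f, g}" "y \<in> carrier T" "z \<in> carrier T" for h y z
    using f g that unfolding trilinear_def by blast+
  note homs = hom[THEN module_hom_add]
  have 1: "f (pure x a) (pure y b) Z = g (pure x a) (pure y b) Z"
    if "x \<in> carrier V" "y \<in> carrier V" "a \<in> carrier W" "b \<in> carrier W" for x y a b
    using Z by (induction rule: tensor_induct) (use that in \<open>auto simp: eq homs pure_closed\<close>)
  have 2: "f (pure x a) Y Z = g (pure x a) Y Z"
    if "x \<in> carrier V" "a \<in> carrier W" for x a
    using Y by (induction rule: tensor_induct) (use that Z in \<open>auto simp: 1 homs pure_closed\<close>)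
  show ?thesis
    using X by (induction rule: tensor_induct) (use Y Z in \<open>auto simp: 2 homs pure_closed\<close>)
qed

end

section \<open>Derivations and the tensor bracket\<close>

lemma module_homI:
  assumes "\<And>v. v \<in> carrier V \<Longrightarrow> f v \<in> carrier W"
    and "\<And>v w. v \<in> carrier V \<Longrightarrow> w \<in> carrier V \<Longrightarrow> f (v \<oplus>\<^bsub>V\<^esub> w) = f v \<oplus>\<^bsub>W\<^esub> f w"
    and "\<And>r v. r \<in> carrier F \<Longrightarrow> v \<in> carrier V \<Longrightarrow> f (r \<odot>\<^bsub>V\<^esub> v) = r \<odot>\<^bsub>W\<^esub> f v"
  shows "f \<in> module_hom F V W"
  using assms unfolding module_hom_def by simp

lemma trilinearD:
  assumes "trilinear F V t" "y \<in> carrier V" "z \<in> carrier V"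
  shows "(\<lambda>x. t x y z) \<in> module_hom F V V" "(\<lambda>x. t y x z) \<in> module_hom F V V"
    "(\<lambda>x. t y z x) \<in> module_hom F V V"
  using assms unfolding trilinear_def by blast+

lemma trilinear_closed:
  assumes "trilinear F V t" "x \<in> carrier V" "y \<in> carrier V" "z \<in> carrier V"
  shows "t x y z \<in> carrier V"
  using module_hom_closed[OF trilinearD(1)[OF assms(1,3,4)]] assms(2) by auto

text \<open>The derivation identity is linear in the map. \<open>G\<close> is compared with the
  pointwise sum on the carrier only, since that is where additivity of the commutator in its
  operator arguments is available.\<close>

lemma derivation_add:
  assumes V: "module F V" and t: "trilinear F V t"
    and D: "derivation F V t D" and E: "derivation F V t E"
    and G: "\<And>v. v \<in> carrier V \<Longrightarrow> G v = D v \<oplus>\<^bsub>V\<^esub> E v"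
  shows "derivation F V t G"
proof -
  interpret V: module F V by (rule V)
  note homs = trilinearD[OF t, THEN module_hom_add]
  have hom: "D \<in> module_hom F V V" "E \<in> module_hom F V V"
    using D E by (simp_all add: derivation_def)
  have closed: "D v \<in> carrier V" "E v \<in> carrier V" if "v \<in> carrier V" for v
    using hom[THEN module_hom_closed] that by auto
  have "G \<in> module_hom F V V"
    by (rule module_homI)
      (auto simp: G closed V.smult_r_distr V.a_ac hom[THEN module_hom_add] hom[THEN module_hom_smult])
  moreover have "G (t x y z) = t (G x) y z \<oplus>\<^bsub>V\<^esub> t x (G y) z \<oplus>\<^bsub>V\<^esub> t x y (G z)"
    if "x \<in> carrier V" "y \<in> carrier V" "z \<in> carrier V" for x y z
    using that D E
    by (simp add: G closed homs trilinear_closed[OF t] derivation_def V.a_ac)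
  ultimately show ?thesis by (simp add: derivation_def)
qed

lemma commutator_hom:
  assumes V: "module F V" and t: "trilinear F V t"
    and "x2 \<in> carrier V" "x3 \<in> carrier V" "y2 \<in> carrier V" "y3 \<in> carrier V"
  shows "commutator V (mult_operator t x2 x3) (mult_operator t y2 y3) \<in> module_hom F V V"
proof -
  interpret V: module F V by (rule V)
  note homs = trilinearD[OF t, THEN module_hom_add] trilinearD[OF t, THEN module_hom_smult]
  show ?thesis
    unfolding commutator_def mult_operator_def
    by (rule module_homI)
      (use assms in \<open>auto simp: homs trilinear_closed[OF t] V.smult_r_distr V.minus_eq
        V.minus_add V.smult_r_minus V.a_ac\<close>)
qed

section \<open>Construction of the tensor bracket\<close>

locale jordan_tensor = A: ternary_jordan_algebra F A t + B: comm_assoc_algebra F B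
  for F :: "('f, 'm) ring_scheme" and A :: "('f, 'a, 'k) module_scheme" and t
    and B :: "('f, 'b, 'l) module_scheme"
begin

sublocale tensor F A B
  by (intro tensor.intro A.module_axioms B.module_axioms)

lemma mult_closed [simp]: "a \<in> carrier B \<Longrightarrow> b \<in> carrier B \<Longrightarrow> a \<otimes>\<^bsub>B\<^esub> b \<in> carrier B"
  using module_hom_closed[OF B.alg_mult_linear] by auto

lemma mult_comm: "a \<in> carrier B \<Longrightarrow> b \<in> carrier B \<Longrightarrow> a \<otimes>\<^bsub>B\<^esub> b = b \<otimes>\<^bsub>B\<^esub> a"
  by (rule B.alg_mult_comm)

lemma mult_left_comm:
  assumes "a \<in> carrier B" "b \<in> carrier B" "c \<in> carrier B"
  shows "a \<otimes>\<^bsub>B\<^esub> (b \<otimes>\<^bsub>B\<^esub> c) = b \<otimes>\<^bsub>B\<^esub> (a \<otimes>\<^bsub>B\<^esub> c)"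
  using assms by (metis B.alg_mult_assoc mult_comm)

lemmas mult_ac = B.alg_mult_assoc mult_comm mult_left_comm

lemma mult_hom_right:
  assumes "a \<in> carrier B"
  shows "(\<lambda>b. a \<otimes>\<^bsub>B\<^esub> b) \<in> module_hom F B B"
  using B.alg_mult_linear[OF assms] assms
  unfolding module_hom_def by (auto simp: mult_comm[of a])

lemmas bracket_closed [simp] = trilinear_closed[OF A.bracket_trilinear]
lemmas bracket_homs = trilinearD[OF A.bracket_trilinear]

lemma bilinearI:
  assumes "\<And>w. w \<in> carrier B \<Longrightarrow> (\<lambda>v. \<beta> v w) \<in> module_hom F A U"
    and "\<And>v. v \<in> carrier A \<Longrightarrow> \<beta> v \<in> module_hom F B U"
  shows "bilinear F A B U \<beta>"
  using assms unfolding bilinear_def by blast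

lemma pure_hom_left: "f \<in> module_hom F M A \<Longrightarrow> b \<in> carrier B \<Longrightarrow> (\<lambda>m. pure (f m) b) \<in> module_hom F M T"
  unfolding module_hom_def by (auto simp: pure_closed pure_add_left pure_smult_left Pi_def)

lemma pure_hom_right: "x \<in> carrier A \<Longrightarrow> f \<in> module_hom F M B \<Longrightarrow> (\<lambda>m. pure x (f m)) \<in> module_hom F M T"
  unfolding module_hom_def by (auto simp: pure_closed pure_add_right pure_smult_right Pi_def)

lemma triple_homs:
  assumes "a \<in> carrier B" "b \<in> carrier B"
  shows "(\<lambda>c. c \<otimes>\<^bsub>B\<^esub> a \<otimes>\<^bsub>B\<^esub> b) \<in> module_hom F B B"
    "(\<lambda>c. a \<otimes>\<^bsub>B\<^esub> c \<otimes>\<^bsub>B\<^esub> b) \<in> module_hom F B B"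
    "(\<lambda>c. a \<otimes>\<^bsub>B\<^esub> b \<otimes>\<^bsub>B\<^esub> c) \<in> module_hom F B B"
proof -
  show "(\<lambda>c. a \<otimes>\<^bsub>B\<^esub> b \<otimes>\<^bsub>B\<^esub> c) \<in> module_hom F B B"
    using assms by (intro mult_hom_right) simp
  then show "(\<lambda>c. c \<otimes>\<^bsub>B\<^esub> a \<otimes>\<^bsub>B\<^esub> b) \<in> module_hom F B B"
    "(\<lambda>c. a \<otimes>\<^bsub>B\<^esub> c \<otimes>\<^bsub>B\<^esub> b) \<in> module_hom F B B"
    using assms unfolding module_hom_def by (auto simp: mult_ac)
qed

text \<open>The pair \<open>(x, a)\<close> is replaced by a tensor \<open>X\<close>, while
  \<open>(y, b)\<close> and \<open>(z, c)\<close> stay as parameters; \<open>ext2\<close> and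
  \<open>ext3\<close> replace these in turn.\<close>

definition ext1 where
  "ext1 X y b z c = lift T (\<lambda>x a. pure (t x y z) (a \<otimes>\<^bsub>B\<^esub> b \<otimes>\<^bsub>B\<^esub> c)) X"

definition ext2 where
  "ext2 X Y z c = lift T (\<lambda>y b. ext1 X y b z c) Y"

definition ext3 where
  "ext3 X Y Z = lift T (\<lambda>z c. ext2 X Y z c) Z"

lemma ext1_bilinear:
  assumes "y \<in> carrier A" "b \<in> carrier B" "z \<in> carrier A" "c \<in> carrier B"
  shows "bilinear F A B T (\<lambda>x a. pure (t x y z) (a \<otimes>\<^bsub>B\<^esub> b \<otimes>\<^bsub>B\<^esub> c))"
  using assms by (intro bilinearI pure_hom_left pure_hom_right bracket_homs triple_homs) auto

lemmas lift_family_T = lift_family[OF _ T.module_axioms]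

text \<open>Linearity in \<open>X\<close> belongs to the lift itself. Linearity in each of the four
  parameters follows from \<open>lift_family\<close>, as the lifted formula is linear in each of
  them.\<close>

lemma ext1_homs:
  assumes "X \<in> carrier T" "y \<in> carrier A" "b \<in> carrier B" "z \<in> carrier A" "c \<in> carrier B"
  shows "(\<lambda>X. ext1 X y b z c) \<in> module_hom F T T"
    "(\<lambda>y. ext1 X y b z c) \<in> module_hom F A T" "(\<lambda>b. ext1 X y b z c) \<in> module_hom F B T"
    "(\<lambda>z. ext1 X y b z c) \<in> module_hom F A T" "(\<lambda>c. ext1 X y b z c) \<in> module_hom F B T"
  unfolding ext1_def using assms
  by (auto intro!: lift_hom lift_family_T T.module_axioms
      A.module_axioms B.module_axioms ext1_bilinear
      pure_hom_left pure_hom_right bracket_homs triple_homs)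

lemma ext1_pure:
  assumes "x \<in> carrier A" "a \<in> carrier B" "y \<in> carrier A" "b \<in> carrier B"
    "z \<in> carrier A" "c \<in> carrier B"
  shows "ext1 (pure x a) y b z c = pure (t x y z) (a \<otimes>\<^bsub>B\<^esub> b \<otimes>\<^bsub>B\<^esub> c)"
  unfolding ext1_def using assms by (intro lift_pure T.module_axioms ext1_bilinear)

lemma ext2_bilinear:
  assumes "X \<in> carrier T" "z \<in> carrier A" "c \<in> carrier B"
  shows "bilinear F A B T (\<lambda>y b. ext1 X y b z c)"
  using assms by (intro bilinearI ext1_homs)

lemma ext2_homs:
  assumes "X \<in> carrier T" "Y \<in> carrier T" "z \<in> carrier A" "c \<in> carrier B"
  shows "(\<lambda>X. ext2 X Y z c) \<in> module_hom F T T" "(\<lambda>Y. ext2 X Y z c) \<in> module_hom F T T"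
    "(\<lambda>z. ext2 X Y z c) \<in> module_hom F A T" "(\<lambda>c. ext2 X Y z c) \<in> module_hom F B T"
  unfolding ext2_def using assms
  by (auto intro!: lift_hom lift_family_T T.module_axioms
      A.module_axioms B.module_axioms ext2_bilinear ext1_homs)

lemma ext2_pure:
  assumes "X \<in> carrier T" "y \<in> carrier A" "b \<in> carrier B" "z \<in> carrier A" "c \<in> carrier B"
  shows "ext2 X (pure y b) z c = ext1 X y b z c"
  unfolding ext2_def using assms by (intro lift_pure T.module_axioms ext2_bilinear)

lemma ext3_bilinear:
  assumes "X \<in> carrier T" "Y \<in> carrier T"
  shows "bilinear F A B T (\<lambda>z c. ext2 X Y z c)"
  \<comment> \<open>\<open>ext2_homs\<close> asks for a member of the carrier even in the place of
    the argument that varies; zero serves as this member.\<close>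
  by (intro bilinearI ext2_homs(3)[OF assms A.zero_closed] ext2_homs(4)[OF assms _ B.zero_closed])

lemma ext3_homs:
  assumes "X \<in> carrier T" "Y \<in> carrier T" "Z \<in> carrier T"
  shows "(\<lambda>X. ext3 X Y Z) \<in> module_hom F T T" "(\<lambda>Y. ext3 X Y Z) \<in> module_hom F T T"
    "(\<lambda>Z. ext3 X Y Z) \<in> module_hom F T T"
  unfolding ext3_def using assms
  by (auto intro!: lift_hom lift_family_T T.module_axioms ext3_bilinear ext2_homs)

lemma ext3_pure:
  assumes "X \<in> carrier T" "Y \<in> carrier T" "z \<in> carrier A" "c \<in> carrier B"
  shows "ext3 X Y (pure z c) = ext2 X Y z c"
  unfolding ext3_def using assms by (intro lift_pure T.module_axioms ext3_bilinear)

lemma ext3_tensor_bracket: "is_tensor_bracket F A t B ext3"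
  unfolding is_tensor_bracket_def trilinear_def
  by (auto simp: ext3_pure ext2_pure ext1_pure pure_closed intro: ext3_homs)

end

section \<open>Jordan structure and perfectness for an arbitrary tensor bracket\<close>

locale jordan_tensor_bracket = jordan_tensor F A t B
  for F :: "('f, 'm) ring_scheme" and A :: "('f, 'a, 'k) module_scheme" and t
    and B :: "('f, 'b, 'l) module_scheme" +
  fixes t'
  assumes tensor_bracket: "is_tensor_bracket F A t B t'"
begin

lemma t'_trilinear: "trilinear F T t'"
  using tensor_bracket by (simp add: is_tensor_bracket_def)

lemma t'_pure:
  assumes "x \<in> carrier A" "y \<in> carrier A" "z \<in> carrier A"
    "a \<in> carrier B" "b \<in> carrier B" "c \<in> carrier B"
  shows "t' (pure x a) (pure y b) (pure z c) = pure (t x y z) (a \<otimes>\<^bsub>B\<^esub> b \<otimes>\<^bsub>B\<^esub> c)"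
  using tensor_bracket assms by (simp add: is_tensor_bracket_def)

lemmas t'_closed [simp] = trilinear_closed[OF t'_trilinear]
lemmas t'_homs = trilinearD[OF t'_trilinear]
lemmas t'_add = t'_homs[THEN module_hom_add]
lemmas t'_smult = t'_homs[THEN module_hom_smult]

text \<open>Permuting arguments keeps a map trilinear, so it is enough to compare pure tensors,
  where symmetry of \<open>t\<close> and commutativity of \<open>B\<close> apply. The two
  transpositions generate all permutations of three arguments.\<close>

lemma t'_swap:
  assumes "X \<in> carrier T" "Y \<in> carrier T" "Z \<in> carrier T"
  shows "t' Y X Z = t' X Y Z" "t' X Z Y = t' X Y Z"
proof -
  have swap: "trilinear F T (\<lambda>X Y Z. t' Y X Z)" "trilinear F T (\<lambda>X Y Z. t' X Z Y)"
    using t'_trilinear unfolding trilinear_def by blast+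
  show "t' Y X Z = t' X Y Z"
    by (rule trilinear_eq[OF swap(1) t'_trilinear])
      (use assms A.bracket_symmetric in \<open>auto simp: t'_pure mult_ac\<close>)
  show "t' X Z Y = t' X Y Z"
    by (rule trilinear_eq[OF swap(2) t'_trilinear])
      (use assms A.bracket_symmetric in \<open>auto simp: t'_pure mult_ac\<close>)
qed

abbreviation "comm x2 x3 y2 y3 \<equiv> commutator A (mult_operator t x2 x3) (mult_operator t y2 y3)"
abbreviation "comm' X2 X3 Y2 Y3 \<equiv> commutator T (mult_operator t' X2 X3) (mult_operator t' Y2 Y3)"

lemmas comm_hom = commutator_hom[OF A.module_axioms A.bracket_trilinear]
lemmas comm'_hom = commutator_hom[OF T.module_axioms t'_trilinear]

lemma pure_minus_left:
  assumes "v \<in> carrier A" "v' \<in> carrier A" "w \<in> carrier B"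
  shows "pure (v \<ominus>\<^bsub>A\<^esub> v') w = pure v w \<ominus>\<^bsub>T\<^esub> pure v' w"
proof -
  interpret h: mod_hom F A T "\<lambda>v. pure v w"
    by unfold_locales (use pure_bilinear assms(3) in \<open>simp add: bilinear_def\<close>)
  show ?thesis using h.f_minus assms by simp
qed

text \<open>Both orders of composition produce the same product of five elements of
  \<open>B\<close>. This common right factor can be taken out of the difference, which leaves the
  commutator of \<open>A\<close> on the left.\<close>

lemma comm'_pure:
  assumes "x2 \<in> carrier A" "x3 \<in> carrier A" "y2 \<in> carrier A" "y3 \<in> carrier A" "v \<in> carrier A"
    and "a2 \<in> carrier B" "a3 \<in> carrier B" "b2 \<in> carrier B" "b3 \<in> carrier B" "c \<in> carrier B"
  shows "comm' (pure x2 a2) (pure x3 a3) (pure y2 b2) (pure y3 b3) (pure v c) =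
    pure (comm x2 x3 y2 y3 v) (a2 \<otimes>\<^bsub>B\<^esub> a3 \<otimes>\<^bsub>B\<^esub> b2 \<otimes>\<^bsub>B\<^esub> b3 \<otimes>\<^bsub>B\<^esub> c)"
  using assms unfolding commutator_def mult_operator_def
  by (simp add: t'_pure pure_minus_left mult_ac)

lemma comm'_derivation_pure:
  assumes "x2 \<in> carrier A" "x3 \<in> carrier A" "y2 \<in> carrier A" "y3 \<in> carrier A"
    and "a2 \<in> carrier B" "a3 \<in> carrier B" "b2 \<in> carrier B" "b3 \<in> carrier B"
  shows "derivation F T t' (comm' (pure x2 a2) (pure x3 a3) (pure y2 b2) (pure y3 b3))"
    (is "derivation F T t' ?D")
proof -
  let ?d = "comm x2 x3 y2 y3"
  have D: "?D \<in> module_hom F T T"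
    using assms by (intro comm'_hom pure_closed)
  have D_closed: "?D X \<in> carrier T" if "X \<in> carrier T" for X
    using module_hom_closed[OF D] that by auto
  have d: "derivation F A t ?d"
    using assms by (intro A.commutator_derivation)
  have d_closed: "?d v \<in> carrier A" if "v \<in> carrier A" for v
    using module_hom_closed[OF comm_hom] assms that by blast
  \<comment> \<open>Both sides of the derivation identity are trilinear in the three tensors, so
    \<open>trilinear_eq\<close> reduces the identity to pure tensors.\<close>
  have lhs: "trilinear F T (\<lambda>X Y Z. ?D (t' X Y Z))"
    unfolding trilinear_def
    by (auto intro!: module_homI simp: D_closed t'_add t'_smult D[THEN module_hom_add]
        D[THEN module_hom_smult])
  have rhs: "trilinear F T (\<lambda>X Y Z. t' (?D X) Y Z \<oplus>\<^bsub>T\<^esub> t' X (?D Y) Z \<oplus>\<^bsub>T\<^esub> t' X Y (?D Z))"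
    unfolding trilinear_def
    by (auto intro!: module_homI simp: D_closed t'_add t'_smult D[THEN module_hom_add]
        D[THEN module_hom_smult] T.smult_r_distr T.a_ac)
  have "?D (t' X Y Z) = t' (?D X) Y Z \<oplus>\<^bsub>T\<^esub> t' X (?D Y) Z \<oplus>\<^bsub>T\<^esub> t' X Y (?D Z)"
    if "X \<in> carrier T" "Y \<in> carrier T" "Z \<in> carrier T" for X Y Z
  proof (rule trilinear_eq[OF lhs rhs _ that])
    fix x y z a b c
    assume *: "x \<in> carrier A" "y \<in> carrier A" "z \<in> carrier A"
      "a \<in> carrier B" "b \<in> carrier B" "c \<in> carrier B"
    have "?d (t x y z) = t (?d x) y z \<oplus>\<^bsub>A\<^esub> t x (?d y) z \<oplus>\<^bsub>A\<^esub> t x y (?d z)"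
      using d * by (simp add: derivation_def)
    then show "?D (t' (pure x a) (pure y b) (pure z c)) =
       t' (?D (pure x a)) (pure y b) (pure z c) \<oplus>\<^bsub>T\<^esub>
       t' (pure x a) (?D (pure y b)) (pure z c) \<oplus>\<^bsub>T\<^esub>
       t' (pure x a) (pure y b) (?D (pure z c))"
      \<comment> \<open>All terms have the same right factor, the product of the seven elements of
        \<open>B\<close>, so the identity for \<open>?d\<close> in \<open>A\<close> transfers by
        additivity on the left.\<close>
      using * assms by (simp add: t'_pure comm'_pure d_closed pure_add_left mult_ac)
  qed
  with D show ?thesis by (simp add: derivation_def)
qed

text \<open>Both nested products are additive in each of the four operator arguments. The pointwise
  form on the carrier matches the hypothesis on \<open>G\<close> in
  \<open>derivation_add\<close>.\<close>

lemma comm'_add: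
  assumes "X \<in> carrier T" "X' \<in> carrier T" "U \<in> carrier T" "V \<in> carrier T" "W \<in> carrier T"
    "v \<in> carrier T"
  shows "comm' (X \<oplus>\<^bsub>T\<^esub> X') U V W v = comm' X U V W v \<oplus>\<^bsub>T\<^esub> comm' X' U V W v"
    "comm' U (X \<oplus>\<^bsub>T\<^esub> X') V W v = comm' U X V W v \<oplus>\<^bsub>T\<^esub> comm' U X' V W v"
    "comm' U V (X \<oplus>\<^bsub>T\<^esub> X') W v = comm' U V X W v \<oplus>\<^bsub>T\<^esub> comm' U V X' W v"
    "comm' U V W (X \<oplus>\<^bsub>T\<^esub> X') v = comm' U V W X v \<oplus>\<^bsub>T\<^esub> comm' U V W X' v"
  using assms unfolding commutator_def mult_operator_def
  by (simp_all add: t'_add T.minus_eq T.minus_add T.a_ac)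

lemmas derivation_add_T = derivation_add[OF T.module_axioms t'_trilinear]

text \<open>Four nested inductions, one for each operator argument: a pure tensor is passed on to
  the next induction, and a sum is settled by \<open>comm'_add\<close> and
  \<open>derivation_add\<close>.\<close>

lemma comm'_derivation:
  assumes X2: "X2 \<in> carrier T" and X3: "X3 \<in> carrier T"
    and Y2: "Y2 \<in> carrier T" and Y3: "Y3 \<in> carrier T"
  shows "derivation F T t' (comm' X2 X3 Y2 Y3)"
  using X2
proof (induction X2 rule: tensor_induct)
  case (pure x2 a2)
  \<comment> \<open>Membership of the factors serves the innermost pure case; membership of the
    tensor itself serves the sums in the later arguments.\<close>
  note p2 = this pure_closed[OF this]
  show ?case using X3
  proof (induction X3 rule: tensor_induct)
    case (pure x3 a3)
    note p3 = this pure_closed[OF this]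
    show ?case using Y2
    proof (induction Y2 rule: tensor_induct)
      case (pure y2 b2)
      note q2 = this pure_closed[OF this]
      show ?case using Y3
      proof (induction Y3 rule: tensor_induct)
        case (pure y3 b3)
        then show ?case using p2 p3 q2 by (intro comm'_derivation_pure)
      next
        case (add X Y)
        then show ?case using p2 p3 q2
          by (intro derivation_add_T[OF add.IH] comm'_add(4))
      qed
    next
      case (add X Y)
      then show ?case using p2 p3 Y3
        by (intro derivation_add_T[OF add.IH] comm'_add(3))
    qed
  next
    case (add X Y)
    then show ?case using p2 Y2 Y3
      by (intro derivation_add_T[OF add.IH] comm'_add(2))
  qed
next
  case (add X Y)
  then show ?case using X3 Y2 Y3
    by (intro derivation_add_T[OF add.IH] comm'_add(1))
qed

lemma tensor_ternary_jordan: "ternary_jordan_algebra F T t'"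
proof (intro ternary_jordan_algebra.intro vectorspace.intro ternary_jordan_algebra_axioms.intro)
  show "module F T" by (rule T.module_axioms)
  show "field F" by (rule A.field_axioms)
  show "trilinear F T t'" by (rule t'_trilinear)
next
  fix X Y Z assume *: "X \<in> carrier T" "Y \<in> carrier T" "Z \<in> carrier T"
  then show "t' X Z Y = t' X Y Z \<and> t' Y X Z = t' X Y Z \<and> t' Y Z X = t' X Y Z \<and>
     t' Z X Y = t' X Y Z \<and> t' Z Y X = t' X Y Z"
    using t'_swap by metis
qed (rule comm'_derivation)

lemma tensor_perfect:
  assumes perfect: "perfect F A t" and unital: "unital B"
  shows "perfect F T t'"
proof -
  let ?G = "{t x y z | x y z. x \<in> carrier A \<and> y \<in> carrier A \<and> z \<in> carrier A}"
  let ?G' = "{t' X Y Z | X Y Z. X \<in> carrier T \<and> Y \<in> carrier T \<and> Z \<in> carrier T}"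
  obtain u where u: "u \<in> carrier B" "\<And>a. a \<in> carrier B \<Longrightarrow> a \<otimes>\<^bsub>B\<^esub> u = a"
    using unital by (auto simp: unital_def)
  have G': "?G' \<subseteq> carrier T" by auto
  interpret S: submodule F "T.span ?G'" T by (rule T.span_is_submodule[OF G'])
  have pure_span: "pure v a \<in> T.span ?G'" if a: "a \<in> carrier B" and v: "v \<in> carrier A" for v a
  proof -
    \<comment> \<open>For fixed \<open>a\<close> these vectors form a submodule. Once it contains
      all products \<open>t x y z\<close>, perfectness of \<open>A\<close> makes it the whole of
      \<open>A\<close>.\<close>
    define K where "K = {v \<in> carrier A. pure v a \<in> T.span ?G'}"
    have "pure \<zero>\<^bsub>A\<^esub> a = \<zero>\<^bsub>T\<^esub>"
      using pure_smult_left[of "\<zero>\<^bsub>F\<^esub>" "\<zero>\<^bsub>A\<^esub>" a] a pure_closed[of "\<zero>\<^bsub>A\<^esub>" a] by simp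
    then have "submodule F K A"
      using a S.m_closed S.zero_closed S.smult_closed
      by (intro submodule.intro A.module_axioms)
        (auto simp: K_def pure_add_left pure_smult_left)
    moreover have "?G \<subseteq> K"
    proof
      fix w assume "w \<in> ?G"
      then obtain x y z where w: "x \<in> carrier A" "y \<in> carrier A" "z \<in> carrier A" "w = t x y z"
        by blast
      \<comment> \<open>The factor \<open>a\<close> goes to one argument and the unit to the other
        two, since \<open>a u u = a\<close>.\<close>
      then have "pure w a = t' (pure x a) (pure y u) (pure z u)"
        using a u by (simp add: t'_pure)
      also have "\<dots> \<in> ?G'" using w a u pure_closed by blast
      finally show "w \<in> K" using T.in_own_span[OF G'] w by (auto simp: K_def)
    qed
    ultimately have "A.span ?G \<subseteq> K" by (intro A.span_is_subset)
    then show ?thesis using perfect v by (auto simp: perfect_def K_def)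
  qed
  have "X \<in> T.span ?G'" if "X \<in> carrier T" for X
    using that by (induction rule: tensor_induct) (auto intro: pure_span S.m_closed)
  then show ?thesis using T.span_is_subset2[OF G'] by (auto simp: perfect_def)
qed

end

text \<open>A tensor bracket is determined on the carrier by its values on pure tensors, but a
  function is arbitrary elsewhere. Hence existence is asserted separately, and the conclusions are
  drawn for every function that meets the specification.\<close>

theorem proposition3p7:
  fixes F :: "('f, 'm) ring_scheme"
    and A :: "('f, 'a, 'k) module_scheme"
    and bracket :: "'a \<Rightarrow> 'a \<Rightarrow> 'a \<Rightarrow> 'a"
    and B :: "('f, 'b, 'l) module_scheme"
  assumes "ternary_jordan_algebra F A bracket"
    and "comm_assoc_algebra F B"
  shows "(\<exists>bracket'. is_tensor_bracket F A bracket B bracket') \<and>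
    (\<forall>bracket'. is_tensor_bracket F A bracket B bracket' \<longrightarrow>
       ternary_jordan_algebra F (tensor_product F A B) bracket' \<and>
       (perfect F A bracket \<and> unital B \<longrightarrow>
          perfect F (tensor_product F A B) bracket'))"
proof -
  interpret jordan_tensor F A bracket B
    using assms by (rule jordan_tensor.intro)
  have "jordan_tensor_bracket F A bracket B bracket'"
    if "is_tensor_bracket F A bracket B bracket'" for bracket'
    using that by unfold_locales
  then show ?thesis
    using ext3_tensor_bracket jordan_tensor_bracket.tensor_ternary_jordan
      jordan_tensor_bracket.tensor_perfect by blast
qed

end
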